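(* Algorithm \textsf{R} (defined below), and hence the equivalent algorithm \textsf{RA}, run on an undirected graph with vertex set $[n]$, $n>1$, takes $O(\lg n)$ steps.
   Context: Each edge $e$ has two ends $e.v,e.w$. Each vertex $v$ has a parent $v.p$, initially $v$; $v$ is a root if $v.p=v$. Vertices are compared as integers. Each operation is performed simultaneously for all edges/vertices using values at the start of the operation. \textsc{connect}: for each current edge $e$, send $\min\{e.v,e.w\}$ to $\max\{e.v,e.w\}$. \textsc{parent-connect}: for each edge $e$, let $x=e.v.p$, $y=e.w.p$; send $\min\{x,y\}$ to $\max\{x,y\}$. \textsc{root-update}: for each root $v$, replace $v.p$ by the minimum of $v.p$ and the vertices sent to $v$ in the preceding connect operation. \textsc{shortcut}: for each vertex $v$, replace $v.p$ by $(v.p).p$. \textsc{alter}: for each edge $e$, let $x=e.v.p$, $y=e.w.p$; if $x=y$ delete $e$, else replace $e.v,e.w$ by $x,y$. Algorithm \textsf{R}: repeat \{\textsc{parent-connect}; \textsc{root-update}; \textsc{shortcut}\} until no parent changes. Algorithm \textsf{RA}: repeat \{\textsc{connect}; \textsc{root-update}; \textsc{shortcut}; \textsc{alter}\} until no parent changes (it makes the same parent changes as \textsf{R}). Each iteration is a round; a round consists of a constant number of synchronous concurrent message-passing steps, so the number of steps is within a constant factor of the number of rounds. $\lg$ is the base-two logarithm. *)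

theory Defs
  imports Complex_Main
begin

text \<open>Vertices are natural numbers, edges are identifiers carrying their two current ends, so loops
  and parallel edges are allowed. Parents are total functions; numbers that are not vertices of
  the graph are never an end of an edge, so they stay their own parent forever.
  \<open>inbox v\<close> holds the vertices sent to \<open>v\<close> by the latest connect operation.\<close>

record state =
  par :: "nat \<Rightarrow> nat"
  edges :: "nat set"
  end_v :: "nat \<Rightarrow> nat"
  end_w :: "nat \<Rightarrow> nat"
  inbox :: "nat \<Rightarrow> nat set"

datatype operation = Connect | Parent_Connect | Root_Update | Shortcut | Alter

definition deliver :: "nat set \<Rightarrow> (nat \<Rightarrow> nat) \<Rightarrow> (nat \<Rightarrow> nat) \<Rightarrow> nat \<Rightarrow> nat set" where
  "deliver E f g x = {min (f e) (g e) | e. e \<in> E \<and> max (f e) (g e) = x}"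

primrec exec :: "operation \<Rightarrow> state \<Rightarrow> state" where
  "exec Connect s = s\<lparr>inbox := deliver (edges s) (end_v s) (end_w s)\<rparr>"
| "exec Parent_Connect s =
     s\<lparr>inbox := deliver (edges s) (\<lambda>e. par s (end_v s e)) (\<lambda>e. par s (end_w s e))\<rparr>"
| "exec Root_Update s =
     s\<lparr>par := \<lambda>v. if par s v = v then Min (insert (par s v) (inbox s v)) else par s v\<rparr>"
| "exec Shortcut s = s\<lparr>par := \<lambda>v. par s (par s v)\<rparr>"
| "exec Alter s =
     s\<lparr>edges := {e \<in> edges s. par s (end_v s e) \<noteq> par s (end_w s e)},
       end_v := \<lambda>e. par s (end_v s e),
       end_w := \<lambda>e. par s (end_w s e)\<rparr>"

definition run_round :: "operation list \<Rightarrow> state \<Rightarrow> state" where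
  "run_round body s = fold exec body s"

definition round_cost :: "(operation \<Rightarrow> nat) \<Rightarrow> operation list \<Rightarrow> nat" where
  "round_cost cost body = sum_list (map cost body)"

text \<open>\<open>loop_steps cost body s k\<close>: the loop ``repeat \<open>body\<close> until no parent changes'', started in
  \<open>s\<close>, terminates after \<open>k\<close> message-passing steps, where operation \<open>q\<close> takes \<open>cost q\<close> steps.
  The final round, in which no parent changes, is counted.\<close>

inductive loop_steps ::
    "(operation \<Rightarrow> nat) \<Rightarrow> operation list \<Rightarrow> state \<Rightarrow> nat \<Rightarrow> bool"
  for cost body where
  stop: "par (run_round body s) = par s \<Longrightarrow> loop_steps cost body s (round_cost cost body)"
| again: "par (run_round body s) \<noteq> par s \<Longrightarrow> loop_steps cost body (run_round body s) k
    \<Longrightarrow> loop_steps cost body s (round_cost cost body + k)"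

lemma loop_steps_unique:
  assumes "loop_steps cost body s k" and "loop_steps cost body s l"
  shows "k = l"
  using assms
proof (induction arbitrary: l rule: loop_steps.induct)
  case (stop s)
  from stop.prems show ?case using stop.hyps by cases simp_all
next
  case (again s k)
  from again.prems show ?case using again.hyps(1) again.IH by cases blast+
qed

definition algorithm_R :: "operation list" where
  "algorithm_R = [Parent_Connect, Root_Update, Shortcut]"

definition algorithm_RA :: "operation list" where
  "algorithm_RA = [Connect, Root_Update, Shortcut, Alter]"

definition is_graph :: "nat \<Rightarrow> nat set \<Rightarrow> (nat \<Rightarrow> nat) \<Rightarrow> (nat \<Rightarrow> nat) \<Rightarrow> bool" where
  "is_graph n E ev ew \<longleftrightarrow> finite E \<and> (\<forall>e\<in>E. ev e \<in> {1..n} \<and> ew e \<in> {1..n})"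

definition initial :: "nat set \<Rightarrow> (nat \<Rightarrow> nat) \<Rightarrow> (nat \<Rightarrow> nat) \<Rightarrow> state" where
  "initial E ev ew =
     \<lparr>par = (\<lambda>v. v), edges = E, end_v = ev, end_w = ew, inbox = (\<lambda>_. {})\<rparr>"

end

theory Submission imports Defs begin

text \<open>
  Call a tree passive if it is flat and the latest round left it unchanged. Two passive trees are
  never adjacent, since the one with the larger root would have linked; so a tree created by links
  always contains an active one. Give each active tree of depth \<open>d\<close> the weight
  \<open>max 4 (d + 1)\<close> and passive trees no weight. Along a path of linked trees passive trees alternate
  with active ones, hence active trees of total weight \<open>w\<close> (and any passive ones) become, after the
  shortcut, a tree of weight at most \<open>(w + 4) / 2\<close>, which is at most \<open>5/6 w\<close> unless \<open>w = 4\<close>.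
  In the exceptional case a single active tree of depth at most 3 meets only passive ones; if this
  goes on for eight rounds, the tree absorbs all its passive neighbours, becomes flat and then
  passive. Thus every eight rounds the total weight, initially \<open>4n\<close>, drops by a factor \<open>5/6\<close>.
\<close>

section \<open>Roots and depths in parent forests\<close>

text \<open>The guard \<open>p v < v\<close> makes the recursion terminate for every
  \<open>p\<close>; for descending \<open>p\<close> it fails exactly at the fixed points, so this is
  the usual root.\<close>

function tree_root :: "(nat \<Rightarrow> nat) \<Rightarrow> nat \<Rightarrow> nat" where
  "tree_root p v = (if p v < v then tree_root p (p v) else v)"
  by auto
termination by (relation "measure snd") auto

function depth :: "(nat \<Rightarrow> nat) \<Rightarrow> nat \<Rightarrow> nat" where
  "depth p v = (if p v < v then Suc (depth p (p v)) else 0)"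
  by auto
termination by (relation "measure snd") auto

declare tree_root.simps [simp del] depth.simps [simp del]

definition descending :: "(nat \<Rightarrow> nat) \<Rightarrow> bool" where
  "descending p \<longleftrightarrow> (\<forall>v. p v \<le> v)"

lemma tree_root_le: "tree_root p v \<le> v"
proof (induction v rule: less_induct)
  case (less v)
  show ?case
    by (subst tree_root.simps) (use less in force)
qed

context
  fixes p :: "nat \<Rightarrow> nat"
  assumes desc: "descending p"
begin

lemma tree_root_fixed: "p (tree_root p v) = tree_root p v"
proof (induction v rule: less_induct)
  case (less v)
  show ?case
    using less desc unfolding descending_def
    by (subst (1 2) tree_root.simps) (auto simp: not_less intro: antisym)
qed

lemma tree_root_self: "p v = v \<Longrightarrow> tree_root p v = v"
  by (simp add: tree_root.simps)

lemma tree_root_parent: "tree_root p (p v) = tree_root p v"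
proof (cases "p v < v")
  case True
  then show ?thesis by (simp add: tree_root.simps[of p v])
next
  case False
  then have "p v = v" using desc by (simp add: descending_def antisym)
  then show ?thesis by simp
qed

lemma depth_parent: "depth p (p v) = depth p v - 1"
proof (cases "p v < v")
  case True
  then show ?thesis by (simp add: depth.simps[of p v])
next
  case False
  then have "p v = v" using desc by (simp add: descending_def antisym)
  then show ?thesis by (simp add: depth.simps)
qed

lemma depth_eq_0_iff: "depth p v = 0 \<longleftrightarrow> p v = v"
  using desc by (subst depth.simps) (auto simp: descending_def order.order_iff_strict)

lemma depth_le_1_iff: "depth p v \<le> 1 \<longleftrightarrow> p v = tree_root p v"
proof -
  have "depth p v \<le> 1 \<longleftrightarrow> depth p (p v) = 0"
    by (simp add: depth_parent)
  also have "\<dots> \<longleftrightarrow> p (p v) = p v"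
    by (rule depth_eq_0_iff)
  also have "\<dots> \<longleftrightarrow> p v = tree_root p v"
    by (metis tree_root_fixed tree_root_parent tree_root_self)
  finally show ?thesis .
qed

lemma descending_shortcut: "descending (p \<circ> p)"
  using desc unfolding descending_def comp_def by (meson order_trans)

lemma tree_root_shortcut: "tree_root (p \<circ> p) v = tree_root p v"
proof (induction v rule: less_induct)
  case (less v)
  show ?case
  proof (cases "p v = v")
    case True
    then show ?thesis by (simp add: tree_root.simps)
  next
    case False
    then have "p (p v) < v"
      using desc unfolding descending_def by (metis le_neq_implies_less order_le_less_trans)
    then have "tree_root (p \<circ> p) v = tree_root (p \<circ> p) (p (p v))"
      by (subst tree_root.simps) simp
    also have "\<dots> = tree_root p (p (p v))"
      using less \<open>p (p v) < v\<close> by blast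
    also have "\<dots> = tree_root p v" by (simp only: tree_root_parent)
    finally show ?thesis .
  qed
qed

lemma depth_shortcut: "depth (p \<circ> p) v = (depth p v + 1) div 2"
proof (induction v rule: less_induct)
  case (less v)
  show ?case
  proof (cases "p v = v")
    case True
    then show ?thesis by (simp add: depth.simps)
  next
    case False
    then have less_v: "p (p v) < v"
      using desc unfolding descending_def by (metis le_neq_implies_less order_le_less_trans)
    then have "depth (p \<circ> p) v = Suc (depth (p \<circ> p) (p (p v)))"
      by (subst depth.simps) simp
    also have "\<dots> = Suc ((depth p (p (p v)) + 1) div 2)"
      using less[OF less_v] by (simp only:)
    also have "\<dots> = Suc ((depth p v - 1 - 1 + 1) div 2)"
      by (simp add: depth_parent)
    also have "\<dots> = (depth p v + 1) div 2"
    proof -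
      have "depth p v \<noteq> 0" using False by (simp add: depth_eq_0_iff)
      then show ?thesis by (cases "depth p v = 1") auto
    qed
    finally show ?thesis .
  qed
qed

text \<open>\<open>q\<close> stands for \<open>p\<close> after links at roots: every path first
  climbs to its root in \<open>p\<close>, and beyond it only \<open>q\<close> matters.\<close>

lemma relinked_tree_root:
  assumes "\<And>v. p v \<noteq> v \<Longrightarrow> q v = p v"
  shows "tree_root q (tree_root p v) = tree_root q v"
proof (induction v rule: less_induct)
  case (less v)
  show ?case
  proof (cases "p v < v")
    case True
    then have "q v = p v" using assms by simp
    with True less show ?thesis
      by (simp add: tree_root.simps[of p v] tree_root.simps[of q v])
  next
    case False
    then show ?thesis by (simp add: tree_root.simps[of p v])
  qed
qed

lemma relinked_depth:
  assumes "\<And>v. p v \<noteq> v \<Longrightarrow> q v = p v"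
  shows "depth q v = depth p v + depth q (tree_root p v)"
proof (induction v rule: less_induct)
  case (less v)
  show ?case
  proof (cases "p v < v")
    case True
    then have "q v = p v" using assms by simp
    with True less show ?thesis
      by (simp add: depth.simps[of p v] depth.simps[of q v] tree_root.simps[of p v])
  next
    case False
    then show ?thesis by (simp add: depth.simps[of p v] tree_root.simps[of p v])
  qed
qed

end

section \<open>One round on weighted trees\<close>

text \<open>\<open>pos v\<close> is a vertex in the tree of \<open>v\<close>, and an edge between \<open>v\<close> and \<open>w\<close> takes part in the connect
  operation with the ends \<open>p (pos v)\<close> and \<open>p (pos w)\<close>. In R, \<open>pos\<close> is the identity;
  in RA, each alteration replaces \<open>pos\<close> by \<open>p \<circ> pos\<close>.\<close>

definition link :: "(nat \<Rightarrow> nat \<Rightarrow> bool) \<Rightarrow> (nat \<Rightarrow> nat) \<Rightarrow> (nat \<Rightarrow> nat) \<Rightarrow> nat \<Rightarrow> nat" where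
  "link adj p pos r = (if p r = r
     then Min (insert r {p (pos w) | v w. adj v w \<and> p (pos v) = r \<and> p (pos w) \<le> r})
     else p r)"

text \<open>\<open>A\<close> contains the roots of the active trees; \<open>W\<close> bounds their weights from above.\<close>

locale configuration =
  fixes adj :: "nat \<Rightarrow> nat \<Rightarrow> bool" and p pos :: "nat \<Rightarrow> nat"
    and A :: "nat set" and W :: "nat \<Rightarrow> nat"
  assumes adj_sym: "adj v w \<Longrightarrow> adj w v"
    and desc: "descending p"
    and pos_tree: "tree_root p (pos v) = tree_root p v"
    and finite_active: "finite A"
    and active_root: "a \<in> A \<Longrightarrow> p a = a"
    and weight_ge: "a \<in> A \<Longrightarrow> 4 \<le> W a"
    and depth_less: "tree_root p v \<in> A \<Longrightarrow> depth p v < W (tree_root p v)"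
    and passive_flat: "tree_root p v \<notin> A \<Longrightarrow> depth p v \<le> 1"
    and passive_independent:
      "adj v w \<Longrightarrow> tree_root p v \<notin> A \<Longrightarrow> tree_root p w \<notin> A \<Longrightarrow> tree_root p v = tree_root p w"
begin

abbreviation "q \<equiv> link adj p pos"

lemma finite_candidates: "finite {p (pos w) | v w. adj v w \<and> p (pos v) = r \<and> p (pos w) \<le> r}"
  by (rule finite_subset[of _ "{..r}"]) auto

lemma link_nonroot: "p v \<noteq> v \<Longrightarrow> q v = p v"
  by (simp add: link_def)

lemma link_le: "q v \<le> v"
  using desc finite_candidates[of v] by (auto simp: link_def descending_def)

lemma link_descending: "descending q"
  using link_le by (simp add: descending_def)

lemma link_min:
  assumes "p r = r" "adj v w" "p (pos v) = r" "p (pos w) \<le> r"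
  shows "q r \<le> p (pos w)"
proof -
  have "Min (insert r {p (pos w) | v w. adj v w \<and> p (pos v) = r \<and> p (pos w) \<le> r}) \<le> p (pos w)"
    by (rule Min_le) (use finite_candidates[of r] assms in auto)
  then show ?thesis using assms by (simp add: link_def)
qed

lemma tree_root_pos: "tree_root p (p (pos v)) = tree_root p v"
  by (simp add: desc tree_root_parent pos_tree)

lemma link_edge:
  assumes "p r = r" "q r \<noteq> r"
  obtains v w where "adj v w" "p (pos v) = r" "q r = p (pos w)" "p (pos w) < r"
    "tree_root p v = r" "tree_root p w < r"
proof -
  have "q r \<in> insert r {p (pos w) | v w. adj v w \<and> p (pos v) = r \<and> p (pos w) \<le> r}"
    unfolding link_def if_P[OF assms(1)] by (rule Min_in) (use finite_candidates[of r] in simp_all)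
  then obtain v w where vw: "adj v w" "p (pos v) = r" "q r = p (pos w)" "p (pos w) \<le> r"
    using assms(2) by auto
  then have lt: "p (pos w) < r" using assms(2) by simp
  have "tree_root p v = r"
    using tree_root_pos[of v] vw(2) assms(1) desc by (simp add: tree_root_self)
  moreover have "tree_root p w < r"
    using tree_root_pos[of w] lt tree_root_le[of p "p (pos w)"] by simp
  ultimately show thesis using that vw lt by blast
qed

lemma tree_root_link: "tree_root q (tree_root p v) = tree_root q v"
  using relinked_tree_root[OF desc, of q] link_nonroot by blast

lemma depth_link: "depth q v = depth p v + depth q (tree_root p v)"
  using relinked_depth[OF desc, of q] link_nonroot by blast

text \<open>A passive tree is flat, so all its edges take part in connecting with its root as their
  end.\<close>

lemma link_passive:
  assumes "tree_root p v \<notin> A"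
  shows "p (pos v) = tree_root p v"
  using assms passive_flat[of "pos v"] depth_le_1_iff[OF desc, of "pos v"] by (simp add: pos_tree)

text \<open>A link ends at a parent, one level above \<open>pos v\<close> unless that is a root,
  where the lower bound 4 on the weight suffices.\<close>

lemma depth_pos_less:
  assumes "tree_root p v \<in> A"
  shows "depth p (p (pos v)) + 2 \<le> W (tree_root p v)"
proof -
  have "depth p (pos v) < W (tree_root p v)"
    using depth_less[of "pos v"] assms by (simp add: pos_tree)
  then show ?thesis using weight_ge[OF assms] by (simp add: depth_parent[OF desc])
qed

definition mass :: "nat \<Rightarrow> nat" where
  "mass b = (\<Sum>a | a \<in> A \<and> tree_root q a = b. W a)"

text \<open>Links lead to smaller roots, so only these active trees can lie above \<open>r\<close>;
  the restriction allows an induction on \<open>r\<close>.\<close>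

definition mass_below :: "nat \<Rightarrow> nat" where
  "mass_below r = (\<Sum>a | a \<in> A \<and> a < r \<and> tree_root q a = tree_root q r. W a)"

lemma mass_below_mono:
  assumes "s < r" "tree_root q s = tree_root q r"
  shows "mass_below s \<le> mass_below r"
  unfolding mass_below_def
  by (rule sum_mono2) (use assms finite_active in auto)

lemma mass_below_add:
  assumes "s < r" "tree_root q s = tree_root q r" "s \<in> A"
  shows "mass_below s + W s \<le> mass_below r"
proof -
  have "mass_below s + W s = sum W (insert s {a. a \<in> A \<and> a < s \<and> tree_root q a = tree_root q s})"
    unfolding mass_below_def using finite_active by simp
  also have "\<dots> \<le> mass_below r"
    unfolding mass_below_def by (rule sum_mono2) (use assms finite_active in auto)
  finally show ?thesis .
qed

lemma mass_below_add_le_mass: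
  assumes "s \<in> A"
  shows "mass_below s + W s \<le> mass (tree_root q s)"
proof -
  have "mass_below s + W s = sum W (insert s {a. a \<in> A \<and> a < s \<and> tree_root q a = tree_root q s})"
    unfolding mass_below_def using finite_active by simp
  also have "\<dots> \<le> mass (tree_root q s)"
    unfolding mass_def by (rule sum_mono2) (use assms finite_active in auto)
  finally show ?thesis .
qed

lemma mass_below_le_mass: "mass_below s \<le> mass (tree_root q s)"
  unfolding mass_def mass_below_def by (rule sum_mono2) (use finite_active in auto)

text \<open>On a path of linked trees passive trees alternate with active ones, and a passive tree
  contributes a single edge, which is paid for by the surplus of the next active tree.\<close>

lemma depth_link_root:
  assumes "p r = r"
  shows "depth q r \<le> mass_below r + (if r \<in> A then 1 else 0)"
  using assms
proof (induction r rule: less_induct)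
  case (less r)
  show ?case
  proof (cases "q r = r")
    case True
    then show ?thesis using depth_eq_0_iff[OF link_descending, of r] by simp
  next
    case False
    then obtain v w where vw: "adj v w" "p (pos v) = r" "q r = p (pos w)" "p (pos w) < r"
      "tree_root p v = r" "tree_root p w < r"
      using link_edge less.prems by metis
    define s where "s = tree_root p w"
    have s: "s < r" "p s = s"
      using vw tree_root_fixed[OF desc] by (simp_all add: s_def)
    have same: "tree_root q s = tree_root q r"
      using tree_root_link[of "p (pos w)"] tree_root_pos[of w] vw(3)
        tree_root_parent[OF link_descending, of r] by (simp add: s_def)
    have "depth q r = Suc (depth q (p (pos w)))"
      using vw by (simp add: depth.simps[of q r])
    also have "\<dots> = Suc (depth p (p (pos w)) + depth q s)"
      using depth_link[of "p (pos w)"] tree_root_pos[of w] by (simp add: s_def)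
    finally have eq: "depth q r = Suc (depth p (p (pos w)) + depth q s)" .
    note IH = less.IH[OF s]
    show ?thesis
    proof (cases "s \<in> A")
      case True
      \<comment> \<open>The two units pay for the link into \<open>s\<close> and for the 1 granted
        to the active \<open>s\<close> by the induction hypothesis.\<close>
      then have "depth p (p (pos w)) + 2 \<le> W s"
        using depth_pos_less[of w] by (simp add: s_def)
      then show ?thesis
        using eq IH mass_below_add[OF s(1) same True] True by simp
    next
      case False
      then have "r \<in> A"
        using passive_independent[OF vw(1)] vw(5) s(1) by (auto simp: s_def)
      moreover have "depth p (p (pos w)) = 0"
        using link_passive[of w] False tree_root_fixed[OF desc]
        by (simp add: s_def depth_eq_0_iff[OF desc])
      ultimately show ?thesis
        using eq IH mass_below_mono[OF s(1) same] False by simp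
    qed
  qed
qed

text \<open>In an active tree \<open>W r\<close> exceeds the depth of \<open>v\<close>, which
  absorbs the 1 of \<open>depth_link_root\<close>; the final 1 is the flat depth of a vertex in a
  passive tree.\<close>

lemma depth_link_le: "depth q v \<le> mass (tree_root q v) + 1"
proof -
  define r where "r = tree_root p v"
  have r: "p r = r" "tree_root q r = tree_root q v"
    using tree_root_fixed[OF desc] tree_root_link by (simp_all add: r_def)
  have eq: "depth q v = depth p v + depth q r"
    using depth_link[of v] by (simp add: r_def)
  show ?thesis
  proof (cases "r \<in> A")
    case True
    then show ?thesis
      using eq depth_less[of v] depth_link_root[OF r(1)] mass_below_add_le_mass[OF True] r(2)
      by (simp add: r_def[symmetric])
  next
    case False
    then show ?thesis
      using eq passive_flat[of v] depth_link_root[OF r(1)] mass_below_le_mass[of r] r(2)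
      by (simp add: r_def[symmetric])
  qed
qed

text \<open>If the root of such a passive tree moved, \<open>passive_independent\<close> would make
  the tree across the linking edge active, and the merged tree would contain an active root.\<close>

lemma unmerged:
  assumes "tree_root q v \<notin> tree_root q ` A"
  shows "tree_root p v = tree_root q v" "tree_root p v \<notin> A" "p v = tree_root q v"
    "q (q v) = tree_root q v" "q (tree_root q v) = tree_root q v"
proof -
  define r where "r = tree_root p v"
  have r: "p r = r" "tree_root q r = tree_root q v"
    using tree_root_fixed[OF desc] tree_root_link by (simp_all add: r_def)
  have rA: "r \<notin> A" using assms r(2) by (metis imageI)
  have qr: "q r = r"
  proof (rule ccontr)
    assume "q r \<noteq> r"
    then obtain x w where xw: "adj x w" "q r = p (pos w)" "tree_root p x = r" "tree_root p w < r"
      using link_edge r(1) by metis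
    then have "tree_root p w \<in> A" using passive_independent[OF xw(1)] rA by auto
    moreover have "tree_root q (tree_root p w) = tree_root q r"
      using tree_root_link[of "p (pos w)"] tree_root_pos[of w] xw(2)
        tree_root_parent[OF link_descending, of r] by simp
    ultimately show False using assms r(2) by (metis imageI)
  qed
  then have rq: "r = tree_root q v"
    using r(2) tree_root_self[OF link_descending] by simp
  show "tree_root p v = tree_root q v" using rq by (simp add: r_def)
  show "tree_root p v \<notin> A" using rA by (simp add: r_def)
  show pv: "p v = tree_root q v"
    using passive_flat[of v] rA rq depth_le_1_iff[OF desc, of v] by (simp add: r_def)
  show "q (tree_root q v) = tree_root q v" using qr rq by simp
  then show "q (q v) = tree_root q v"
    using link_nonroot[of v] pv by (cases "p v = v") auto
qed

lemma tree_root_round: "tree_root (q \<circ> q) v = tree_root q v"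
  by (rule tree_root_shortcut[OF link_descending])

lemma depth_round: "depth (q \<circ> q) v = (depth q v + 1) div 2"
  by (rule depth_shortcut[OF link_descending])

text \<open>The shortcut turns depth \<open>mass b + 1\<close> into at most
  \<open>(mass b + 2) div 2\<close>, one below the new weight; for active \<open>b\<close>,
  \<open>mass b >= 4\<close> keeps that weight at least 4. The two choices of \<open>pos'\<close>
  serve R and RA.\<close>

lemma configuration_round:
  assumes "pos' = pos \<or> pos' = p \<circ> pos"
  shows "configuration adj (q \<circ> q) pos' (tree_root q ` A) (\<lambda>b. (mass b + 4) div 2)"
proof
  show "\<And>v w. adj v w \<Longrightarrow> adj w v" by (rule adj_sym)
  show "descending (q \<circ> q)" by (rule descending_shortcut[OF link_descending])
  show "tree_root (q \<circ> q) (pos' v) = tree_root (q \<circ> q) v" for v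
  proof -
    have "tree_root p (pos' v) = tree_root p v"
      using assms pos_tree tree_root_pos by auto
    then show ?thesis by (metis tree_root_link tree_root_round)
  qed
  show "finite (tree_root q ` A)" using finite_active by simp
  show "(q \<circ> q) b = b" if "b \<in> tree_root q ` A" for b
    using that tree_root_fixed[OF link_descending] by auto
  show "4 \<le> (mass b + 4) div 2" if "b \<in> tree_root q ` A" for b
  proof -
    from that obtain a where "a \<in> A" "b = tree_root q a" by auto
    then have "W a \<le> mass b" using mass_below_add_le_mass by fastforce
    then show ?thesis using weight_ge[OF \<open>a \<in> A\<close>] by simp
  qed
  show "depth (q \<circ> q) v < (mass (tree_root (q \<circ> q) v) + 4) div 2" for v
    using depth_link_le[of v] by (simp add: tree_root_round depth_round)
  show "depth (q \<circ> q) v \<le> 1" if "tree_root (q \<circ> q) v \<notin> tree_root q ` A" for v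
    using that unmerged(4)[of v] depth_le_1_iff[OF descending_shortcut[OF link_descending], of v]
    by (simp add: tree_root_round del: One_nat_def)
  show "tree_root (q \<circ> q) v = tree_root (q \<circ> q) w"
    if "adj v w" "tree_root (q \<circ> q) v \<notin> tree_root q ` A"
      "tree_root (q \<circ> q) w \<notin> tree_root q ` A" for v w
    using that passive_independent[OF that(1)] unmerged(1,2)[of v] unmerged(1,2)[of w]
    by (simp add: tree_root_round)
qed

text \<open>Without another active tree \<open>mass_below r\<close> vanishes, so
  \<open>depth_link_root\<close> leaves room for one link only.\<close>

lemma depth_link_solo:
  assumes "r \<in> A" and "\<And>a. a \<in> A \<Longrightarrow> tree_root q a = tree_root q r \<Longrightarrow> a = r"
  shows "depth q r = (if q r = r then 0 else 1)"
proof -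
  have "{a. a \<in> A \<and> a < r \<and> tree_root q a = tree_root q r} = {}"
    using assms(2) by auto
  then have "mass_below r = 0" by (simp only: mass_below_def sum.empty)
  then show ?thesis
    using depth_link_root[of r] active_root[OF assms(1)] assms(1)
      depth_eq_0_iff[OF link_descending, of r] by auto
qed

end

section \<open>Runs of several rounds\<close>

text \<open>\<open>alt\<close> is true for RA, whose alterations advance \<open>pos\<close>. Within
  a run activity is only inherited from \<open>A0\<close>; nothing is reclassified.\<close>

locale window =
  fixes adj :: "nat \<Rightarrow> nat \<Rightarrow> bool" and alt :: bool and P pos :: "nat \<Rightarrow> nat \<Rightarrow> nat"
    and A0 :: "nat set" and W0 :: "nat \<Rightarrow> nat"
  assumes start: "configuration adj (P 0) (pos 0) A0 W0"
    and P_Suc: "P (Suc j) = link adj (P j) (pos j) \<circ> link adj (P j) (pos j)"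
    and pos_Suc: "pos (Suc j) = (if alt then P j \<circ> pos j else pos j)"
begin

abbreviation "R j \<equiv> tree_root (P j)"
abbreviation "L j \<equiv> link adj (P j) (pos j)"

definition A :: "nat \<Rightarrow> nat set" where
  "A j = R j ` A0"

text \<open>The sum is \<open>mass\<close> of round \<open>j\<close>, spelled out because only
  afterwards are the rounds shown to be configurations.\<close>

primrec W :: "nat \<Rightarrow> nat \<Rightarrow> nat" where
  "W 0 = W0"
| "W (Suc j) = (\<lambda>b. ((\<Sum>a | a \<in> A j \<and> tree_root (L j) a = b. W j a) + 4) div 2)"

lemma A_0: "A 0 = A0"
proof -
  interpret configuration adj "P 0" "pos 0" A0 W0 by (rule start)
  show ?thesis
    unfolding A_def using active_root tree_root_self[OF desc] by force
qed

lemma configuration_at: "configuration adj (P j) (pos j) (A j) (W j)"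
proof (induction j)
  case 0
  then show ?case using start by (simp add: A_0)
next
  case (Suc j)
  interpret configuration adj "P j" "pos j" "A j" "W j" by (rule Suc)
  have "R (Suc j) v = tree_root (L j) (R j v)" for v
    by (simp only: P_Suc tree_root_round tree_root_link)
  then have "A (Suc j) = tree_root (L j) ` A j"
    unfolding A_def image_image by (intro image_cong refl)
  moreover have "W (Suc j) = (\<lambda>b. (mass b + 4) div 2)"
    by (simp add: mass_def)
  moreover have "pos (Suc j) = pos j \<or> pos (Suc j) = P j \<circ> pos j"
    by (simp add: pos_Suc)
  ultimately show ?case
    using configuration_round[of "pos (Suc j)"] by (simp only: P_Suc)
qed

sublocale c: configuration adj "P j" "pos j" "A j" "W j" for j
  by (rule configuration_at)

lemma R_Suc: "R (Suc j) v = tree_root (L j) v"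
  by (simp only: P_Suc c.tree_root_round)

lemma R_R: "i \<le> j \<Longrightarrow> R j (R i v) = R j v"
proof (induction j rule: dec_induct)
  case base
  then show ?case using c.desc tree_root_fixed tree_root_self by blast
next
  case (step j)
  have "R (Suc j) u = R (Suc j) (R j u)" for u
    by (simp only: R_Suc c.tree_root_link)
  then show ?case using step by metis
qed

lemma R_decreasing: "i \<le> j \<Longrightarrow> R j v \<le> R i v"
  by (metis R_R tree_root_le)

lemma active_later: "a \<in> A i \<Longrightarrow> i \<le> j \<Longrightarrow> R j a \<in> A j"
  by (auto simp: A_def R_R)

lemma unmerged_at:
  assumes "R (Suc j) v \<notin> A (Suc j)"
  shows "R j v = R (Suc j) v" "R j v \<notin> A j" "P j v = R (Suc j) v"
    "L j (R (Suc j) v) = R (Suc j) v"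
proof -
  have "tree_root (L j) v \<notin> tree_root (L j) ` A j"
    using assms active_later[of _ j "Suc j"] by (auto simp: R_Suc[symmetric])
  then show "R j v = R (Suc j) v" "R j v \<notin> A j" "P j v = R (Suc j) v"
    "L j (R (Suc j) v) = R (Suc j) v"
    using c.unmerged by (simp_all add: R_Suc)
qed

lemma passive_before:
  assumes "R j v \<notin> A j" "i \<le> j"
  shows "R i v = R j v \<and> R i v \<notin> A i"
  using assms(2,1)
proof (induction j rule: dec_induct)
  case (step j)
  then show ?case using unmerged_at[of j v] by metis
qed simp

definition total :: "nat \<Rightarrow> nat \<Rightarrow> nat" where
  "total j b = (\<Sum>a | a \<in> A0 \<and> R j a = b. W0 a)"

lemma finite_A0: "finite A0"
  using c.finite_active[of 0] by (simp add: A_0)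

lemma total_Suc: "total (Suc j) b = (\<Sum>a | a \<in> A j \<and> R (Suc j) a = b. total j a)"
proof -
  let ?S = "{a. a \<in> A0 \<and> R (Suc j) a = b}" and ?T = "{a. a \<in> A j \<and> R (Suc j) a = b}"
  have "total (Suc j) b = (\<Sum>y\<in>?T. \<Sum>x | x \<in> ?S \<and> R j x = y. W0 x)"
    unfolding total_def
    by (rule sum.group[symmetric]) (use finite_A0 c.finite_active in \<open>auto simp: A_def R_R\<close>)
  also have "\<dots> = (\<Sum>y\<in>?T. total j y)"
    unfolding total_def by (rule sum.cong) (auto simp: R_R intro!: sum.cong)
  finally show ?thesis .
qed

lemma weight_Suc: "W (Suc j) b = ((\<Sum>a | a \<in> A j \<and> R (Suc j) a = b. W j a) + 4) div 2"
  by (simp add: R_Suc)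

text \<open>With \<open>M\<close> the sum, \<open>3 * (M + 4) \<le> 5 * M\<close> holds from
  \<open>M = 6\<close> on, with equality there, which fixes the ratio 5/6; \<open>M = 4\<close> and
  \<open>M = 5\<close> both give weight 4.\<close>

lemma weight_le_sum:
  assumes "b \<in> A (Suc j)"
  shows "W (Suc j) b \<le> (\<Sum>a | a \<in> A j \<and> R (Suc j) a = b. W j a)"
    "W (Suc j) b = 4 \<or> 6 * W (Suc j) b \<le> 5 * (\<Sum>a | a \<in> A j \<and> R (Suc j) a = b. W j a)"
proof -
  define M where "M = (\<Sum>a | a \<in> A j \<and> R (Suc j) a = b. W j a)"
  have eq: "W (Suc j) b = (M + 4) div 2" unfolding M_def by (rule weight_Suc)
  have "4 \<le> M" using c.weight_ge[OF assms] eq by simp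
  then show "W (Suc j) b \<le> (\<Sum>a | a \<in> A j \<and> R (Suc j) a = b. W j a)"
    "W (Suc j) b = 4 \<or> 6 * W (Suc j) b \<le> 5 * (\<Sum>a | a \<in> A j \<and> R (Suc j) a = b. W j a)"
    unfolding M_def[symmetric] eq by presburger+
qed

lemma weight_le_total: "b \<in> A j \<Longrightarrow> W j b \<le> total j b"
proof (induction j arbitrary: b)
  case 0
  then have "b \<in> {a. a \<in> A0 \<and> R 0 a = b}"
    using c.active_root[of b 0] tree_root_self[OF c.desc] by (simp add: A_0)
  then have "W0 b \<le> total 0 b"
    unfolding total_def using finite_A0 by (intro member_le_sum) auto
  then show ?case by simp
next
  case (Suc j)
  have "W (Suc j) b \<le> (\<Sum>a | a \<in> A j \<and> R (Suc j) a = b. W j a)"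
    by (rule weight_le_sum) (rule Suc)
  also have "\<dots> \<le> total (Suc j) b"
    unfolding total_Suc by (rule sum_mono) (use Suc.IH in auto)
  finally show ?case .
qed

text \<open>In the exceptional case of weight 4, \<open>total\<close> is at least 5 and 24 \<le> 25.
  Only the last round has to contract, as weights never exceed their totals.\<close>

lemma weight_contracts:
  assumes "b \<in> A (Suc j)" "4 < total (Suc j) b"
  shows "6 * W (Suc j) b \<le> 5 * total (Suc j) b"
proof -
  have "(\<Sum>a | a \<in> A j \<and> R (Suc j) a = b. W j a) \<le> total (Suc j) b"
    unfolding total_Suc by (rule sum_mono) (use weight_le_total in auto)
  then show ?thesis using weight_le_sum(2)[OF assms(1)] assms(2) by linarith
qed

end

section \<open>A light active tree among passive trees\<close>

text \<open>An active tree of depth at most 3 that merges only with passive trees. Only its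
  original vertices \<open>v\<close>, those with \<open>R 0 v = a\<close>, can have passive neighbours.\<close>

locale solo_window = window +
  fixes a :: nat
  assumes a_active: "a \<in> A 0"
    and solo: "a' \<in> A 0 \<Longrightarrow> R 8 a' = R 8 a \<Longrightarrow> a' = a"
    and light: "W0 a \<le> 4"
begin

abbreviation "r j \<equiv> R j a"

text \<open>Merging is permanent, so another active tree that joins the tree of \<open>a\<close>
  would share its root after round 8, against \<open>solo\<close>.\<close>

lemma only_active:
  assumes "b \<in> A i" "i \<le> j" "j \<le> 8" "R j b = r j"
  shows "b = r i"
proof -
  obtain a' where "a' \<in> A0" and b: "b = R i a'" using assms(1) by (auto simp: A_def)
  then have a': "a' \<in> A 0" by (simp add: A_0)
  have "R 8 a' = R 8 (R j a')" by (rule R_R[OF assms(3), symmetric])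
  also have "\<dots> = R 8 (R j b)" unfolding b by (simp only: R_R[OF assms(2)])
  also have "\<dots> = R 8 a" unfolding assms(4) by (rule R_R[OF assms(3)])
  finally show ?thesis using solo[OF a'] b by simp
qed

lemma r_active: "r j \<in> A j"
  using active_later[OF a_active] by simp

lemma shallow:
  assumes "j \<le> 8" "R j v = r j"
  shows "depth (P j) v \<le> 3"
proof -
  have "{a'. a' \<in> A0 \<and> R j a' = r j} = {a}"
    using only_active[of _ 0 j] assms(1) a_active
      tree_root_self[OF c.desc c.active_root[OF a_active]]
    by (auto simp: A_0)
  then have "total j (r j) \<le> 4" using light by (simp add: total_def)
  then have "W j (r j) \<le> 4" using weight_le_total[OF r_active] by (meson order_trans)
  moreover have "depth (P j) v < W j (r j)"
    using c.depth_less[of j v] r_active assms(2) by simp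
  ultimately show ?thesis by simp
qed

lemma r_Suc_le: "r (Suc j) \<le> L j (r j)"
proof -
  have "r (Suc j) = tree_root (L j) (r j)"
    by (simp only: R_Suc c.tree_root_link)
  also have "\<dots> = tree_root (L j) (L j (r j))"
    using tree_root_parent[OF c.link_descending] by simp
  also have "\<dots> \<le> L j (r j)" by (rule tree_root_le)
  finally show ?thesis .
qed

lemma r_fixed: "P j (r j) = r j"
  by (rule tree_root_fixed[OF c.desc])

lemma r_stays_iff: "L j (r j) = r j \<longleftrightarrow> r (Suc j) = r j"
proof
  assume "L j (r j) = r j"
  then show "r (Suc j) = r j"
    using tree_root_self[OF c.link_descending] R_Suc c.tree_root_link by metis
next
  assume "r (Suc j) = r j"
  then show "L j (r j) = r j" using r_Suc_le[of j] c.link_le[of j "r j"] by simp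
qed

lemma depth_step:
  assumes "j < 8" "R j v = r j"
  shows "depth (P (Suc j)) v = (depth (P j) v + (if r (Suc j) = r j then 0 else 1) + 1) div 2"
proof -
  have "depth (L j) (r j) = (if L j (r j) = r j then 0 else 1)"
  proof (rule c.depth_link_solo[OF r_active])
    fix b assume b: "b \<in> A j" "tree_root (L j) b = tree_root (L j) (r j)"
    then have "R (Suc j) b = r (Suc j)" by (simp add: R_Suc c.tree_root_link)
    then show "b = r j" using only_active[OF b(1), of "Suc j"] assms(1) by simp
  qed
  then show ?thesis
    using c.depth_round[of j v] c.depth_link[of j v] assms(2) r_stays_iff[of j] by (simp add: P_Suc)
qed

text \<open>The tree of \<open>w\<close> has been passive from the start. Had \<open>v\<close>
  started in a passive tree, \<open>passive_independent\<close> would put both in the same tree; so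
  \<open>v\<close> started in an active one, which can only be that of \<open>a\<close>.\<close>

lemma passive_neighbour_original:
  assumes "adj v w" "R j w \<notin> A j" "R j v = r j" "j \<le> 8"
  shows "R 0 v = a"
proof -
  have w: "R 0 w = R j w" "R 0 w \<notin> A 0" using passive_before[OF assms(2), of 0] by blast+
  have "R 0 v \<in> A 0"
  proof (rule ccontr)
    assume "R 0 v \<notin> A 0"
    then have "R 0 v = R 0 w" using c.passive_independent[OF assms(1)] w(2) by blast
    then have "R j v = R j w" using R_R[of 0 j] by (metis zero_le)
    then show False using assms(2,3) r_active[of j] by simp
  qed
  moreover have "R j (R 0 v) = r j" using assms(3) by (simp add: R_R)
  ultimately have "R 0 v = r 0" using only_active[of "R 0 v" 0 j] assms(4) by simp
  then show ?thesis
    using tree_root_self[OF c.desc c.active_root[OF a_active]] by simp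
qed

lemma original_stays: "R 0 v = a \<Longrightarrow> R j v = r j"
  using R_R[of 0 j v] by simp

lemma merging_passive:
  assumes "j < 8" "R j v \<noteq> r j" "R (Suc j) v = r (Suc j)"
  shows "R j v \<notin> A j"
  using only_active[of "R j v" j "Suc j"] assms R_R[of j "Suc j" v] by auto

lemma moving_edge:
  assumes "j < 8" "r (Suc j) \<noteq> r j"
  obtains v w where "adj v w" "R 0 v = a" "P j (pos j v) = r j" "R j w \<notin> A j" "R j w < r j"
proof -
  have "L j (r j) \<noteq> r j" using assms r_stays_iff by simp
  then obtain v w where vw: "adj v w" "P j (pos j v) = r j" "L j (r j) = P j (pos j w)"
    "R j v = r j" "R j w < r j"
    using c.link_edge[OF r_fixed] by metis
  have "R (Suc j) w = tree_root (L j) (R j w)" by (simp only: R_Suc c.tree_root_link)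
  also have "\<dots> = tree_root (L j) (P j (pos j w))"
    using c.tree_root_link[of j "P j (pos j w)"] c.tree_root_pos by simp
  also have "\<dots> = tree_root (L j) (r j)"
    using vw(3) tree_root_parent[OF c.link_descending, of j "r j"] by simp
  also have "\<dots> = r (Suc j)" by (simp only: R_Suc c.tree_root_link)
  finally have "R j w \<notin> A j" using merging_passive[of j w] assms(1) vw(5) by simp
  moreover have "R 0 v = a"
    using passive_neighbour_original[OF vw(1) calculation vw(4)] assms(1) by simp
  ultimately show thesis using that vw by blast
qed

text \<open>The root links to the minimum over all exposed vertices, and a vertex that is not yet
  exposed does not become exposed in a round in which the root moves.\<close>

lemma no_consecutive_moves:
  assumes "\<not> alt" "Suc j < 8" "r (Suc j) \<noteq> r j"
  shows "r (Suc (Suc j)) = r (Suc j)"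
proof (rule ccontr)
  assume "r (Suc (Suc j)) \<noteq> r (Suc j)"
  then obtain v w where vw: "adj v w" "R 0 v = a" "P (Suc j) (pos (Suc j) v) = r (Suc j)"
    "R (Suc j) w \<notin> A (Suc j)" "R (Suc j) w < r (Suc j)"
    using moving_edge assms(2) by metis
  define u where "u = pos j v"
  have u: "P (Suc j) u = r (Suc j)" using vw(3) assms(1) by (simp add: pos_Suc u_def)
  have Ru: "R j u = r j" using original_stays[OF vw(2)] c.pos_tree by (simp add: u_def)
  have "R (Suc j) u = r (Suc j)" using Ru R_R[of j "Suc j"] by (metis le_Suc_eq order_refl)
  then have "depth (P (Suc j)) u \<le> 1" using u depth_le_1_iff[OF c.desc] by metis
  \<comment> \<open>The root moved in round \<open>j\<close>, so depth \<open>d\<close> became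
    \<open>(d + 2) div 2\<close>, which is at most 1 only if \<open>d\<close> was: \<open>v\<close>
    was exposed already.\<close>
  then have "depth (P j) u \<le> 1" using depth_step[OF _ Ru] assms by simp
  then have Pu: "P j (pos j v) = r j" using depth_le_1_iff[OF c.desc] Ru by (metis u_def)
  have w: "R j w = R (Suc j) w" "R j w \<notin> A j" using unmerged_at[OF vw(4)] by simp_all
  then have Pw: "P j (pos j w) = R (Suc j) w" using c.link_passive by simp
  \<comment> \<open>So the root of \<open>w\<close> was a candidate in round \<open>j\<close>
    already, and \<open>r j\<close> moved at least as low.\<close>
  have "L j (r j) \<le> R (Suc j) w"
    using c.link_min[OF r_fixed vw(1) Pu] Pw vw(5) R_decreasing[of j "Suc j" a] by simp
  then show False using r_Suc_le[of j] vw(5) by simp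
qed

text \<open>An original vertex \<open>v\<close> is exposed once this depth is at most 1, for then
  its edges connect at the root. An alteration saves one level.\<close>

lemma exposure_step:
  assumes "j < 8" "R 0 v = a" and d: "d = depth (P j) (pos j v)"
  shows "depth (P (Suc j)) (pos (Suc j) v) =
    ((if alt then d - 1 else d) + (if r (Suc j) = r j then 0 else 1) + 1) div 2"
proof -
  have "R j (pos j v) = r j" "R j (P j (pos j v)) = r j"
    using original_stays[OF assms(2)] c.pos_tree c.tree_root_pos by simp_all
  then show ?thesis
    using depth_step[OF assms(1)] depth_parent[OF c.desc, of j "pos j v"] by (simp add: pos_Suc d)
qed

text \<open>From depth 3 the first round leaves at most 2. Depth 2 survives only in R and only while
  the root moves, which does not happen twice in a row; from depth at most 1 there is no return to
  2.\<close>

lemma exposed: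
  assumes "R 0 v = a"
  shows "depth (P 3) (pos 3 v) \<le> 1" "depth (P 4) (pos 4 v) \<le> 1"
proof -
  define d where "d j = depth (P j) (pos j v)" for j
  have step: "d k = ((if alt then d j - 1 else d j) + (if r k = r j then 0 else 1) + 1) div 2"
    if "k = Suc j" "j < 8" for j k
    unfolding d_def that(1) using exposure_step[OF that(2) assms] by simp
  have "d 0 \<le> 3"
    unfolding d_def using shallow[of 0 "pos 0 v"] c.pos_tree original_stays[OF assms] by simp
  then have d1: "d 1 \<le> 2" using step[of 1 0] by (auto split: if_splits)
  have "d 2 \<le> 2 \<and> (d 2 \<le> 1 \<or> \<not> alt \<and> r 2 \<noteq> r 1)"
    using step[of 2 1] d1 by (auto split: if_splits)
  moreover have "\<not> alt \<Longrightarrow> r 2 \<noteq> r 1 \<Longrightarrow> r 3 = r 2"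
    using no_consecutive_moves[of 1] by (simp add: eval_nat_numeral)
  ultimately have d3: "d 3 \<le> 1"
    using step[of 3 2] by (auto split: if_splits)
  then have "d 4 \<le> 1" using step[of 4 3] by (auto split: if_splits)
  with d3 show "depth (P 3) (pos 3 v) \<le> 1" "depth (P 4) (pos 4 v) \<le> 1"
    by (simp_all add: d_def)
qed

text \<open>An exposed \<open>v\<close> brings the roots of both trees together. Had
  \<open>w\<close> the larger root, its tree would have linked and ceased to be passive; having the
  smaller one, it pulls the root of \<open>a\<close> at least as low.\<close>

lemma remaining_neighbour:
  assumes "adj v w" "R 0 v = a" "R (Suc j) w \<notin> A (Suc j)" "depth (P j) (pos j v) \<le> 1"
  shows "R j w < r j" "r (Suc j) < R (Suc j) w"
proof -
  define x where "x = R (Suc j) w"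
  have x: "R j w = x" "R j w \<notin> A j" "L j x = x" using unmerged_at[OF assms(3)] by (simp_all add: x_def)
  have Pw: "P j (pos j w) = x" using c.link_passive x by simp
  have Pv: "P j (pos j v) = r j"
    using assms(4) depth_le_1_iff[OF c.desc, of j "pos j v"] c.pos_tree original_stays[OF assms(2)]
    by simp
  have "x \<noteq> r j" using x r_active[of j] by auto
  moreover have "\<not> r j < x"
  proof
    assume "r j < x"
    moreover have "P j x = x" using x(1) tree_root_fixed[OF c.desc] by metis
    ultimately have "L j x \<le> r j" using c.link_min[OF _ c.adj_sym[OF assms(1)] Pw] Pv by simp
    then show False using x \<open>r j < x\<close> by simp
  qed
  ultimately have less: "x < r j" by simp
  then show "R j w < r j" using x by simp
  have "r (Suc j) \<le> x" using c.link_min[OF r_fixed assms(1) Pv] Pw less r_Suc_le[of j] by simp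
  moreover have "x \<noteq> r (Suc j)" using assms(3) r_active[of "Suc j"] by (auto simp: x_def)
  ultimately show "r (Suc j) < R (Suc j) w" by (simp add: x_def)
qed

text \<open>Two successive instances of \<open>remaining_neighbour\<close> clash: for
  \<open>j = 3\<close> it puts \<open>r 4\<close> below the root of \<open>w\<close>, for
  \<open>j = 4\<close> above it.\<close>

lemma neighbours_active:
  assumes "adj v w" "R 0 v = a" "5 \<le> j"
  shows "R j w \<in> A j"
proof (rule ccontr)
  assume "R j w \<notin> A j"
  then have p5: "R (Suc 4) w \<notin> A (Suc 4)" using passive_before[of j w 5] assms(3) by auto
  then have p4: "R (Suc 3) w \<notin> A (Suc 3)" using unmerged_at(2)[of 4 w] by simp
  show False
    using remaining_neighbour(1)[OF assms(1,2) p5] remaining_neighbour(2)[OF assms(1,2) p4]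
      exposed[OF assms(2)] by simp
qed

lemma root_settled:
  assumes "5 \<le> j" "j < 8"
  shows "r (Suc j) = r j"
proof (rule ccontr)
  assume "r (Suc j) \<noteq> r j"
  then obtain v w where "adj v w" "R 0 v = a" "R j w \<notin> A j"
    using moving_edge[OF assms(2)] by metis
  then show False using neighbours_active assms(1) by blast
qed

text \<open>A passive tree joining a root that stays must itself link, by
  \<open>passive_independent\<close> to an active tree, hence to that of \<open>a\<close>; but its
  original vertices have no passive neighbours by then.\<close>

lemma tree_settled:
  assumes "5 \<le> j" "j < 8" "R (Suc j) v = r (Suc j)"
  shows "R j v = r j"
proof (rule ccontr)
  assume ne: "R j v \<noteq> r j"
  define y where "y = R j v"
  have yA: "y \<notin> A j" using merging_passive[OF assms(2) ne assms(3)] by (simp add: y_def)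
  have Py: "P j y = y" unfolding y_def by (rule tree_root_fixed[OF c.desc])
  have y_root: "tree_root (L j) y = r (Suc j)"
    using assms(3) by (simp add: R_Suc y_def c.tree_root_link)
  have "L j y \<noteq> y"
    using y_root root_settled[OF assms(1,2)] ne tree_root_self[OF c.link_descending, of j y]
    by (auto simp: y_def)
  then obtain u w where uw: "adj u w" "L j y = P j (pos j w)" "R j u = y" "R j w < y"
    using c.link_edge[OF Py] by metis
  have w_act: "R j w \<in> A j" using c.passive_independent[OF uw(1), of j] uw yA by auto
  have "tree_root (L j) (R j w) = tree_root (L j) (P j (pos j w))"
    using c.tree_root_link[of j "P j (pos j w)"] c.tree_root_pos by simp
  also have "\<dots> = r (Suc j)"
    using uw(2) tree_root_parent[OF c.link_descending, of j y] y_root by simp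
  finally have "R (Suc j) (R j w) = r (Suc j)" by (simp add: R_Suc)
  then have w_tree: "R j w = r j" using only_active[OF w_act, of "Suc j"] assms(2) by simp
  have "R 0 w = a"
    using passive_neighbour_original[OF c.adj_sym[OF uw(1)] _ w_tree] uw(3) yA assms(2) by simp
  then show False
    using neighbours_active[OF c.adj_sym[OF uw(1)] _ assms(1)] uw(3) yA by simp
qed

text \<open>This accounts for the eight rounds: five rid the tree of passive neighbours, two bring
  depth 3 to 2 and then 1, and the last confirms that the root stays.\<close>

lemma becomes_passive:
  assumes "R 8 v = r 8"
  shows "P 7 v = r 8"
proof -
  have R7: "R 7 v = r 7" using tree_settled[of 7 v] assms by simp
  have R6: "R 6 v = r 6" using tree_settled[of 6 v] R7 by simp
  have R5: "R 5 v = r 5" using tree_settled[of 5 v] R6 by simp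
  have "depth (P 5) v \<le> 3" using shallow[OF _ R5] by simp
  then have "depth (P 6) v \<le> 2" using depth_step[OF _ R5] root_settled[of 5] by simp
  then have "depth (P 7) v \<le> 1" using depth_step[OF _ R6] root_settled[of 6] by simp
  then have "P 7 v = r 7" using depth_le_1_iff[OF c.desc] R7 by metis
  then show ?thesis using root_settled[of 7] by simp
qed

end

section \<open>Reclassification after eight rounds\<close>

context window
begin

text \<open>After eight rounds the trees that are flat and were left unchanged by the last round are
  reclassified as passive.\<close>

definition survivors :: "nat set" where
  "survivors = {b \<in> A 8. \<exists>v. R 8 v = b \<and> P 7 v \<noteq> b}"

text \<open>Initial weights are at least 4, so a total of at most 4 means a single light active
  tree, which \<open>becomes_passive\<close> excludes from \<open>survivors\<close>.\<close>

lemma survivor_heavy: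
  assumes "b \<in> survivors"
  shows "4 < total 8 b"
proof (rule ccontr)
  assume le: "\<not> 4 < total 8 b"
  obtain a where a: "a \<in> A0" "b = R 8 a" using assms by (auto simp: survivors_def A_def)
  let ?S = "{a. a \<in> A0 \<and> R 8 a = b}"
  have split: "total 8 b = W0 a + sum W0 (?S - {a})"
    unfolding total_def using finite_A0 a by (subst sum.remove[of _ a]) auto
  have W_ge: "4 \<le> W0 a'" if "a' \<in> A0" for a'
    using c.weight_ge[of a' 0] that by (simp add: A_0)
  interpret solo_window adj alt P pos A0 W0 a
  proof
    show "a \<in> A 0" using a by (simp add: A_0)
    show "W0 a \<le> 4" using split le by simp
    show "a' = a" if "a' \<in> A 0" "R 8 a' = R 8 a" for a'
    proof (rule ccontr)
      assume "a' \<noteq> a"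
      then have "a' \<in> ?S - {a}" using that a by (simp add: A_0)
      then have "W0 a' \<le> sum W0 (?S - {a})" using finite_A0 by (intro member_le_sum) auto
      then show False using split le W_ge[OF a(1)] W_ge[of a'] that by (simp add: A_0)
    qed
  qed
  show False using becomes_passive assms a by (auto simp: survivors_def)
qed

lemma survivors_weight: "6 * sum (W 8) survivors \<le> 5 * sum W0 A0"
proof -
  have fin: "finite survivors" using c.finite_active[of 8] by (simp add: survivors_def)
  have "6 * W 8 b \<le> 5 * total 8 b" if "b \<in> survivors" for b
    using weight_contracts[of b 7] survivor_heavy[OF that] that by (simp add: survivors_def)
  then have "(\<Sum>b\<in>survivors. 6 * W 8 b) \<le> (\<Sum>b\<in>survivors. 5 * total 8 b)"
    by (rule sum_mono)
  then have "6 * sum (W 8) survivors \<le> 5 * sum (total 8) survivors"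
    by (simp add: sum_distrib_left)
  moreover have "sum (total 8) survivors \<le> sum (total 8) (A 8)"
    by (rule sum_mono2) (use c.finite_active[of 8] in \<open>auto simp: survivors_def\<close>)
  moreover have "sum (total 8) (A 8) = sum W0 A0"
    unfolding total_def
    by (rule sum.group) (use finite_A0 c.finite_active in \<open>auto simp: A_def\<close>)
  ultimately show ?thesis by simp
qed

text \<open>A tree outside \<open>survivors\<close> was flat with the same root before the eighth
  round, hence connected at its root. An edge between two such trees would have made the larger root
  link.\<close>

lemma configuration_survivors: "configuration adj (P 8) (pos 8) survivors (W 8)"
proof
  have sub: "survivors \<subseteq> A 8" by (auto simp: survivors_def)
  have flat: "P 7 v = R 8 v" if "R 8 v \<notin> survivors" for v
    using that unmerged_at(3)[of 7 v] by (auto simp: survivors_def)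
  have R7: "R 7 v = R 8 v" if "R 8 v \<notin> survivors" for v
  proof -
    have "P 7 (R 8 v) = R 8 v"
      using flat[of "R 8 v"] that R_R[of 8 8 v] by simp
    then show ?thesis
      using flat[OF that] tree_root_parent[OF c.desc, of 7 v] tree_root_self[OF c.desc] by metis
  qed
  show "\<And>v w. adj v w \<Longrightarrow> adj w v" by (rule c.adj_sym)
  show "descending (P 8)" by (rule c.desc)
  show "\<And>v. R 8 (pos 8 v) = R 8 v" by (rule c.pos_tree)
  show "finite survivors" using c.finite_active[of 8] sub finite_subset by blast
  show "\<And>b. b \<in> survivors \<Longrightarrow> P 8 b = b" "\<And>b. b \<in> survivors \<Longrightarrow> 4 \<le> W 8 b"
    using c.active_root[of _ 8] c.weight_ge[of _ 8] sub by blast+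
  show "\<And>v. R 8 v \<in> survivors \<Longrightarrow> depth (P 8) v < W 8 (R 8 v)"
    using c.depth_less[of 8] sub by blast
  show "depth (P 8) v \<le> 1" if "R 8 v \<notin> survivors" for v
  proof -
    have "L 7 (R 8 v) = R 8 v"
    proof (rule antisym)
      have "P 8 (R 8 v) = R 8 v" by (rule tree_root_fixed[OF c.desc])
      then have "L 7 (L 7 (R 8 v)) = R 8 v" using P_Suc[of 7] by simp
      then show "R 8 v \<le> L 7 (R 8 v)" using c.link_le by metis
    qed (rule c.link_le)
    then have "depth (L 7) (R 8 v) = 0"
      using depth_eq_0_iff[OF c.link_descending] by simp
    moreover have "depth (P 7) v \<le> 1"
      using flat[OF that] R7[OF that] depth_le_1_iff[OF c.desc, of 7 v] by simp
    ultimately have "depth (L 7) v \<le> 1" using c.depth_link[of 7 v] R7[OF that] by simp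
    then show ?thesis using c.depth_round[of 7 v] P_Suc[of 7] by simp
  qed
  have no_edge: False
    if "adj v w" "R 8 v \<notin> survivors" "R 8 w \<notin> survivors" "R 8 w < R 8 v" for v w
  proof -
    have pos7: "P 7 (pos 7 u) = R 8 u" if "R 8 u \<notin> survivors" for u
    proof -
      have "R 7 (pos 7 u) = R 7 u" by (rule c.pos_tree)
      then have "R 8 (pos 7 u) = R 8 u" using R_R[of 7 8 u] R_R[of 7 8 "pos 7 u"] by simp
      then show ?thesis using flat[of "pos 7 u"] that by simp
    qed
    have root: "P 7 (R 8 v) = R 8 v"
      using R7[OF that(2)] tree_root_fixed[OF c.desc, of 7 v] by simp
    have "L 7 (R 8 v) \<le> R 8 w"
      using c.link_min[OF root that(1)] pos7 that by simp
    then have "L 7 (L 7 (R 8 v)) < R 8 v"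
      using c.link_le[of 7 "L 7 (R 8 v)"] that(4) by simp
    moreover have "L 7 (L 7 (R 8 v)) = R 8 v"
      using tree_root_fixed[OF c.desc, of 8 v] P_Suc[of 7] by simp
    ultimately show False by simp
  qed
  show "R 8 v = R 8 w" if "adj v w" "R 8 v \<notin> survivors" "R 8 w \<notin> survivors" for v w
    using no_edge[OF that] no_edge[OF c.adj_sym[OF that(1)] that(3,2)] by force
qed

end

section \<open>Geometric decay of the total weight\<close>

definition round_map ::
    "(nat \<Rightarrow> nat \<Rightarrow> bool) \<Rightarrow> bool \<Rightarrow> (nat \<Rightarrow> nat) \<times> (nat \<Rightarrow> nat) \<Rightarrow> (nat \<Rightarrow> nat) \<times> (nat \<Rightarrow> nat)" where
  "round_map adj alt x =
     (link adj (fst x) (snd x) \<circ> link adj (fst x) (snd x), if alt then fst x \<circ> snd x else snd x)"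

lemma eight_rounds:
  assumes "configuration adj (fst x) (snd x) A W"
  obtains A' W' where
    "configuration adj (fst ((round_map adj alt ^^ 8) x)) (snd ((round_map adj alt ^^ 8) x)) A' W'"
    "6 * sum W' A' \<le> 5 * sum W A"
proof -
  interpret w: window adj alt "\<lambda>j. fst ((round_map adj alt ^^ j) x)"
    "\<lambda>j. snd ((round_map adj alt ^^ j) x)" A W
    by (rule window.intro) (use assms in \<open>simp_all add: round_map_def\<close>)
  show thesis using that w.configuration_survivors w.survivors_weight by blast
qed

lemma many_rounds:
  assumes "configuration adj (fst x) (snd x) A W"
  shows "\<exists>A' W'. configuration adj (fst ((round_map adj alt ^^ (8 * m)) x))
      (snd ((round_map adj alt ^^ (8 * m)) x)) A' W' \<and> 6 ^ m * sum W' A' \<le> 5 ^ m * sum W A"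
proof (induction m)
  case 0
  show ?case using assms by auto
next
  case (Suc m)
  define y where "y = (round_map adj alt ^^ (8 * m)) x"
  from Suc obtain A1 W1 where 1: "configuration adj (fst y) (snd y) A1 W1"
    "6 ^ m * sum W1 A1 \<le> 5 ^ m * sum W A"
    by (auto simp: y_def)
  obtain A2 W2 where 2:
    "configuration adj (fst ((round_map adj alt ^^ 8) y)) (snd ((round_map adj alt ^^ 8) y)) A2 W2"
    "6 * sum W2 A2 \<le> 5 * sum W1 A1"
    by (rule eight_rounds[OF 1(1), where alt = alt])
  have "(round_map adj alt ^^ 8) y = (round_map adj alt ^^ (8 * Suc m)) x"
    by (simp only: y_def funpow_add comp_apply mult_Suc_right)
  moreover have "6 ^ Suc m * sum W2 A2 \<le> 5 ^ Suc m * sum W A"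
  proof -
    have "6 ^ Suc m * sum W2 A2 = 6 ^ m * (6 * sum W2 A2)" by simp
    also have "\<dots> \<le> 6 ^ m * (5 * sum W1 A1)" using 2(2) by (rule mult_left_mono) simp
    also have "\<dots> = 5 * (6 ^ m * sum W1 A1)" by simp
    also have "\<dots> \<le> 5 * (5 ^ m * sum W A)" using 1(2) by simp
    finally show ?thesis by simp
  qed
  ultimately show ?case using 2(1) by metis
qed

lemma (in configuration) no_active_stable:
  assumes "A = {}"
  shows "q \<circ> q = p"
  using unmerged(3,4) assms by (auto simp: fun_eq_iff)

lemma initial_configuration:
  assumes "\<And>v w. adj v w \<Longrightarrow> adj w v" and "\<And>v w. adj v w \<Longrightarrow> v \<in> V" and "finite V"
  shows "configuration adj (\<lambda>v. v) (\<lambda>v. v) V (\<lambda>_. 4)"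
proof -
  have "tree_root (\<lambda>v. v) v = v" "depth (\<lambda>v. v) v = 0" for v
    by (simp_all add: tree_root.simps depth.simps)
  then show ?thesis
    by unfold_locales (use assms in \<open>auto simp: descending_def\<close>)
qed

lemma stable_after_logarithmic:
  assumes "\<And>v w. adj v w \<Longrightarrow> adj w v" and "\<And>v w. adj v w \<Longrightarrow> v \<in> {1..n}" and "n < 2 ^ l"
  shows "fst ((round_map adj alt ^^ Suc (32 * l)) (\<lambda>v. v, \<lambda>v. v)) =
    fst ((round_map adj alt ^^ (32 * l)) (\<lambda>v. v, \<lambda>v. v))"
proof -
  let ?x = "(\<lambda>v::nat. v, \<lambda>v::nat. v)"
  define y where "y = (round_map adj alt ^^ (32 * l)) ?x"
  have "configuration adj (fst ?x) (snd ?x) {1..n} (\<lambda>_. 4)"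
    using initial_configuration[of adj "{1..n}"] assms(1,2) by simp
  \<comment> \<open>Four windows for each factor 2, because
    \<open>2 * 5 ^ 4 = 1250 < 1296 = 6 ^ 4\<close>; this makes \<open>8 * 4 * l = 32 * l\<close>
    rounds.\<close>
  from many_rounds[OF this, where alt = alt and m = "4 * l"] obtain A W where
    cfg: "configuration adj (fst y) (snd y) A W" and
    weight: "6 ^ (4 * l) * sum W A \<le> 5 ^ (4 * l) * (\<Sum>a\<in>{1..n}. 4)"
    by (auto simp: y_def)
  interpret configuration adj "fst y" "snd y" A W by (rule cfg)
  have "A = {}"
  proof (rule ccontr)
    assume "A \<noteq> {}"
    then obtain a where a: "a \<in> A" by blast
    then have "4 \<le> sum W A"
      using weight_ge[OF a] member_le_sum[of a A W] finite_active by simp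
    then have "6 ^ (4 * l) * 4 \<le> 6 ^ (4 * l) * sum W A" by simp
    also have "\<dots> \<le> 5 ^ (4 * l) * (4 * n)" using weight by simp
    also have "\<dots> < 5 ^ (4 * l) * (4 * 2 ^ l)" using assms(3) by simp
    finally have "(1296::nat) ^ l < 625 ^ l * 2 ^ l" by (simp add: power_mult)
    also have "\<dots> = 1250 ^ l" by (simp add: power_mult_distrib[symmetric])
    also have "\<dots> \<le> 1296 ^ l" by (rule power_mono) simp_all
    finally show False by simp
  qed
  then have "fst (round_map adj alt y) = fst y"
    using no_active_stable by (simp add: round_map_def)
  then show ?thesis by (simp add: y_def)
qed

section \<open>Simulation of the two algorithms\<close>

definition adjacent :: "nat set \<Rightarrow> (nat \<Rightarrow> nat) \<Rightarrow> (nat \<Rightarrow> nat) \<Rightarrow> nat \<Rightarrow> nat \<Rightarrow> bool" where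
  "adjacent E ev ew v w \<longleftrightarrow> (\<exists>e\<in>E. ev e = v \<and> ew e = w \<or> ev e = w \<and> ew e = v)"

text \<open>\<open>F\<close> is meant as the set of edges still present: all of \<open>E\<close> in
  R, the undeleted ones in RA. A missing edge could send only \<open>r\<close> to \<open>r\<close>,
  which the inserted \<open>r\<close> absorbs.\<close>

lemma link_deliver:
  assumes "F \<subseteq> E" and "\<And>e. e \<in> E - F \<Longrightarrow> p (pos (ev e)) = p (pos (ew e))"
  shows "link (adjacent E ev ew) p pos = (\<lambda>r. if p r = r
    then Min (insert (p r) (deliver F (\<lambda>e. p (pos (ev e))) (\<lambda>e. p (pos (ew e))) r)) else p r)"
proof
  fix r
  let ?N = "{p (pos w) | v w. adjacent E ev ew v w \<and> p (pos v) = r \<and> p (pos w) \<le> r}"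
  let ?D = "deliver F (\<lambda>e. p (pos (ev e))) (\<lambda>e. p (pos (ew e))) r"
  have "?D \<subseteq> ?N"
  proof
    fix x assume "x \<in> ?D"
    then obtain e where e: "e \<in> F" "max (p (pos (ev e))) (p (pos (ew e))) = r"
      "x = min (p (pos (ev e))) (p (pos (ew e)))"
      unfolding deliver_def by blast
    then have adj: "adjacent E ev ew (ev e) (ew e)" "adjacent E ev ew (ew e) (ev e)"
      using assms(1) by (auto simp: adjacent_def)
    show "x \<in> ?N"
    proof (cases "p (pos (ev e)) \<le> p (pos (ew e))")
      case True
      then have "p (pos (ew e)) = r" "x = p (pos (ev e))" "p (pos (ev e)) \<le> r" using e by auto
      then show ?thesis using adj(2) by blast
    next
      case False
      then have "p (pos (ev e)) = r" "x = p (pos (ew e))" "p (pos (ew e)) \<le> r" using e by auto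
      then show ?thesis using adj(1) by blast
    qed
  qed
  moreover have "?N \<subseteq> insert r ?D"
  proof
    fix x assume "x \<in> ?N"
    then obtain v w where vw: "adjacent E ev ew v w" "p (pos v) = r" "p (pos w) \<le> r" "x = p (pos w)"
      by blast
    then obtain e where e: "e \<in> E" "ev e = v \<and> ew e = w \<or> ev e = w \<and> ew e = v"
      by (auto simp: adjacent_def)
    have mm: "min (p (pos (ev e))) (p (pos (ew e))) = x" "max (p (pos (ev e))) (p (pos (ew e))) = r"
      using e(2) vw by auto
    show "x \<in> insert r ?D"
    proof (cases "e \<in> F")
      case True
      then show ?thesis using mm unfolding deliver_def by blast
    next
      case False
      then show ?thesis using mm assms(2)[of e] e(1) by simp
    qed
  qed
  ultimately have "insert r ?N = insert r ?D" by blast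
  then show "link (adjacent E ev ew) p pos r = (if p r = r then Min (insert (p r) ?D) else p r)"
    unfolding link_def by simp
qed

lemma simulation_R:
  fixes E :: "nat set" and ev ew :: "nat \<Rightarrow> nat"
  defines "x \<equiv> \<lambda>j. (round_map (adjacent E ev ew) False ^^ j) (\<lambda>v. v, \<lambda>v. v)"
    and "s \<equiv> \<lambda>j. (run_round algorithm_R ^^ j) (initial E ev ew)"
  shows "par (s j) = fst (x j) \<and> snd (x j) = (\<lambda>v. v) \<and>
    edges (s j) = E \<and> end_v (s j) = ev \<and> end_w (s j) = ew"
proof (induction j)
  case 0
  then show ?case by (simp add: x_def s_def initial_def)
next
  case (Suc j)
  have x: "x (Suc j) = round_map (adjacent E ev ew) False (x j)" by (simp add: x_def)
  have s: "s (Suc j) = run_round algorithm_R (s j)" by (simp add: s_def)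
  define q where "q = (\<lambda>r. if par (s j) r = r then Min (insert (par (s j) r)
    (deliver (edges (s j)) (\<lambda>e. par (s j) (end_v (s j) e)) (\<lambda>e. par (s j) (end_w (s j) e)) r))
    else par (s j) r)"
  have "link (adjacent E ev ew) (fst (x j)) (snd (x j)) = q"
    unfolding q_def by (subst link_deliver[of E]) (use Suc in \<open>simp_all cong: if_cong\<close>)
  moreover have "par (s (Suc j)) = q \<circ> q"
    unfolding s q_def by (simp add: run_round_def algorithm_R_def comp_def cong: if_cong)
  ultimately show ?case
    using Suc by (simp add: x round_map_def) (simp add: s run_round_def algorithm_R_def)
qed

text \<open>The alterations of RA move the ends of an edge farther up than the parents consulted by R,
  so a root can move earlier in RA than in R. Deleted edges would send
  their common end to itself, which has no effect.\<close>

lemma simulation_RA: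
  fixes E :: "nat set" and ev ew :: "nat \<Rightarrow> nat"
  defines "x \<equiv> \<lambda>j. (round_map (adjacent E ev ew) True ^^ j) (\<lambda>v. v, \<lambda>v. v)"
    and "s \<equiv> \<lambda>j. (run_round algorithm_RA ^^ j) (initial E ev ew)"
  shows "par (s j) = fst (x j) \<and> edges (s j) \<subseteq> E \<and>
    end_v (s j) = (\<lambda>e. fst (x j) (snd (x j) (ev e))) \<and>
    end_w (s j) = (\<lambda>e. fst (x j) (snd (x j) (ew e))) \<and>
    (\<forall>e \<in> E - edges (s j). end_v (s j) e = end_w (s j) e)"
proof (induction j)
  case 0
  then show ?case by (simp add: x_def s_def initial_def)
next
  case (Suc j)
  have x: "x (Suc j) = round_map (adjacent E ev ew) True (x j)" by (simp add: x_def)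
  have s: "s (Suc j) = run_round algorithm_RA (s j)" by (simp add: s_def)
  define q where "q = (\<lambda>r. if par (s j) r = r
    then Min (insert (par (s j) r) (deliver (edges (s j)) (end_v (s j)) (end_w (s j)) r))
    else par (s j) r)"
  have "link (adjacent E ev ew) (fst (x j)) (snd (x j)) = q"
    unfolding q_def by (subst link_deliver[of "edges (s j)"]) (use Suc in auto)
  then have x': "fst (x (Suc j)) = q \<circ> q" "snd (x (Suc j)) = fst (x j) \<circ> snd (x j)"
    by (simp_all add: x round_map_def)
  have s': "par (s (Suc j)) = q \<circ> q"
    "edges (s (Suc j)) = {e \<in> edges (s j). (q \<circ> q) (end_v (s j) e) \<noteq> (q \<circ> q) (end_w (s j) e)}"
    "end_v (s (Suc j)) = (\<lambda>e. (q \<circ> q) (end_v (s j) e))"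
    "end_w (s (Suc j)) = (\<lambda>e. (q \<circ> q) (end_w (s j) e))"
    unfolding s q_def by (simp_all add: run_round_def algorithm_RA_def comp_def cong: if_cong)
  have "e \<in> edges (s j)" if "e \<in> E" "(q \<circ> q) (end_v (s j) e) \<noteq> (q \<circ> q) (end_w (s j) e)" for e
  proof (rule ccontr)
    assume "e \<notin> edges (s j)"
    then have "end_v (s j) e = end_w (s j) e" using Suc that(1) by blast
    then show False using that(2) by simp
  qed
  then have "\<forall>e \<in> E - edges (s (Suc j)). end_v (s (Suc j)) e = end_w (s (Suc j)) e"
    unfolding s' by blast
  moreover have "edges (s (Suc j)) \<subseteq> E" unfolding s' using Suc by blast
  \<comment> \<open>Altering applies the new parents to the old ends, and an old end is the new
    position of its original vertex.\<close>
  moreover have "end_v (s (Suc j)) = (\<lambda>e. fst (x (Suc j)) (snd (x (Suc j)) (ev e)))"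
    "end_w (s (Suc j)) = (\<lambda>e. fst (x (Suc j)) (snd (x (Suc j)) (ew e)))"
    unfolding x' s' using Suc by simp_all
  moreover have "par (s (Suc j)) = fst (x (Suc j))" unfolding x' s' ..
  ultimately show ?case by blast
qed

section \<open>Counting steps\<close>

text \<open>The first stable round ends the loop, possibly early; \<open>Suc m\<close> includes the
  final round, in which no parent changes.\<close>

lemma loop_steps_bound:
  assumes "par ((run_round body ^^ Suc m) s) = par ((run_round body ^^ m) s)"
  shows "\<exists>k. loop_steps cost body s k \<and> k \<le> Suc m * round_cost cost body"
  using assms
proof (induction m arbitrary: s)
  case 0
  then show ?case using loop_steps.stop[of body s cost] by auto
next
  case (Suc m)
  show ?case
  proof (cases "par (run_round body s) = par s")
    case True
    then show ?thesis using loop_steps.stop[of body s cost] by auto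
  next
    case False
    have "par ((run_round body ^^ Suc m) (run_round body s)) = par ((run_round body ^^ m) (run_round body s))"
      using Suc.prems by (simp add: funpow_swap1)
    from Suc.IH[OF this] obtain k where "loop_steps cost body (run_round body s) k"
      "k \<le> Suc m * round_cost cost body" by blast
    then show ?thesis using loop_steps.again[OF False] by fastforce
  qed
qed

theorem theorem20:
  fixes cost :: "operation \<Rightarrow> nat"
  shows "\<exists>C::real. \<forall>n::nat. n > 1 \<longrightarrow> (\<forall>E ev ew. is_graph n E ev ew \<longrightarrow>
    (\<exists>k. loop_steps cost algorithm_R (initial E ev ew) k \<and> real k \<le> C * log 2 (real n)) \<and>
    (\<exists>k. loop_steps cost algorithm_RA (initial E ev ew) k \<and> real k \<le> C * log 2 (real n)))"
proof -
  \<comment> \<open>The sum bounds the cost of a round of either algorithm, so one constant serves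
    both.\<close>
  define c where "c = round_cost cost algorithm_R + round_cost cost algorithm_RA"
  have bound: "\<exists>k. loop_steps cost body (initial E ev ew) k \<and> real k \<le> 65 * real c * log 2 (real n)"
    if n: "n > 1" and graph: "is_graph n E ev ew" and c: "round_cost cost body \<le> c"
      and sim: "\<And>j. par ((run_round body ^^ j) (initial E ev ew)) =
        fst ((round_map (adjacent E ev ew) alt ^^ j) (\<lambda>v. v, \<lambda>v. v))"
    for n E ev ew body alt
  proof -
    \<comment> \<open>\<open>i\<close> is the integer part of the logarithm; \<open>Suc i\<close>
      becomes the \<open>l\<close> of \<open>stable_after_logarithmic\<close>.\<close>
    obtain i where i: "2 ^ i \<le> n" "n < 2 ^ Suc i"
      using ex_power_ivl1[of 2 n] n by auto
    have "2 ^ i \<le> real n" using i(1) of_nat_mono[of "2 ^ i" n] by simp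
    then have "real i \<le> log 2 (real n)" by (simp add: le_log_of_power)
    moreover have "1 \<le> log 2 (real n)" using n by (simp add: le_log_iff)
    \<comment> \<open>The left side is \<open>32 * i + 33\<close>, and both \<open>i\<close> and 1
      are at most the logarithm: 32 + 33 = 65.\<close>
    ultimately have rounds: "real (Suc (32 * Suc i)) \<le> 65 * log 2 (real n)" by simp
    have "fst ((round_map (adjacent E ev ew) alt ^^ Suc (32 * Suc i)) (\<lambda>v. v, \<lambda>v. v)) =
      fst ((round_map (adjacent E ev ew) alt ^^ (32 * Suc i)) (\<lambda>v. v, \<lambda>v. v))"
    proof (rule stable_after_logarithmic[OF _ _ i(2)])
      show "adjacent E ev ew w v" if "adjacent E ev ew v w" for v w
        using that by (auto simp: adjacent_def)
      show "v \<in> {1..n}" if "adjacent E ev ew v w" for v w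
        using that graph by (auto simp: adjacent_def is_graph_def)
    qed
    then have "par ((run_round body ^^ Suc (32 * Suc i)) (initial E ev ew)) =
        par ((run_round body ^^ (32 * Suc i)) (initial E ev ew))"
      by (simp only: sim)
    from loop_steps_bound[OF this] obtain k where k: "loop_steps cost body (initial E ev ew) k"
      "k \<le> Suc (32 * Suc i) * round_cost cost body" by blast
    have "real k \<le> real (Suc (32 * Suc i)) * real (round_cost cost body)"
      using k(2) by (metis of_nat_le_iff of_nat_mult)
    also have "\<dots> \<le> (65 * log 2 (real n)) * real c"
      using rounds c by (intro mult_mono) auto
    finally show ?thesis using k(1) by (auto simp: mult_ac)
  qed
  show ?thesis
  proof (intro exI[of _ "65 * real c"] allI impI conjI)
    fix n :: nat and E ev ew
    assume n: "1 < n" "is_graph n E ev ew"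
    show "\<exists>k. loop_steps cost algorithm_R (initial E ev ew) k \<and> real k \<le> 65 * real c * log 2 (real n)"
      using bound[OF n, of algorithm_R False] simulation_R by (simp add: c_def)
    show "\<exists>k. loop_steps cost algorithm_RA (initial E ev ew) k \<and> real k \<le> 65 * real c * log 2 (real n)"
      using bound[OF n, of algorithm_RA True] simulation_RA by (simp add: c_def)
  qed
qed

end
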